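(* Let $h=(h(n))_{n\ge1}$ be a sequence of positive real numbers with $h(1)=1$. For every $n\ge1$, \[ P_n^h(z)=\det\left(zH_n^{-1}L_n-U_n\right). \]
   Context: Let $\sigma(k)=\sum_{d\mid k}d$. The generalized D'Arcais polynomials are defined by $P_0^h(z)=1$ and $P_n^h(z)=\frac{z}{h(n)}\sum_{k=1}^n\sigma(k)P_{n-k}^h(z)$ for $n\ge1$. The $n\times n$ matrices are: $H_n=\operatorname{diag}(h(1),h(2),\ldots,h(n))$; $L_n$ with entries $(L_n)_{ij}=\sigma(i-j+1)$ if $i\ge j$ and $(L_n)_{ij}=0$ if $i<j$; and $U_n$ with entries $(U_n)_{ij}=1$ if $j=i+1$ and $(U_n)_{ij}=0$ otherwise. *)

theory Defs
  imports Complex_Main "HOL-Computational_Algebra.Polynomial"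
    "Jordan_Normal_Form.Determinant" "Jordan_Normal_Form.Gauss_Jordan_Elimination"
begin

(* Only used for k >= 1: divisor_sigma 0 is a sum over an infinite set, hence 0. *)
definition divisor_sigma :: "nat \<Rightarrow> nat" where
  "divisor_sigma k = (\<Sum>d | d dvd k. d)"

(* The factor [:0, 1 / h n:] is z / h(n); the value h 0 is never used. *)
function darcais_poly :: "(nat \<Rightarrow> real) \<Rightarrow> nat \<Rightarrow> complex poly" where
  "darcais_poly h 0 = 1"
| "darcais_poly h (Suc n) =
     [:0, 1 / complex_of_real (h (Suc n)):] *
       (\<Sum>k = 1..Suc n. of_nat (divisor_sigma k) * darcais_poly h (Suc n - k))"
  by pat_completeness auto
termination by (relation "measure snd") auto

(* Matrix indices start at 0, so the entry in row i and column j of the paper is found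
   at index (i - 1, j - 1). *)
(* If h is nonzero on {1..n}, this matrix is invertible, so mat_inverse (an option-valued
   function) returns Some of its inverse. *)
definition H_mat :: "(nat \<Rightarrow> real) \<Rightarrow> nat \<Rightarrow> complex mat" where
  "H_mat h n = mat n n (\<lambda>(i, j). if i = j then complex_of_real (h (i + 1)) else 0)"

definition L_mat :: "nat \<Rightarrow> complex mat" where
  "L_mat n = mat n n (\<lambda>(i, j). if i \<ge> j then of_nat (divisor_sigma (i - j + 1)) else 0)"

definition U_mat :: "nat \<Rightarrow> complex mat" where
  "U_mat n = mat n n (\<lambda>(i, j). if j = i + 1 then 1 else 0)"

end

theory Submission imports Defs
begin

text \<open>The matrix is lower Hessenberg with entries \<open>-1\<close> on the superdiagonal. The recurrence for
  \<open>P\<^sub>k = P\<^sub>k\<^sup>h(z)\<close> says that it maps the column \<open>(P\<^sub>0, \<dots>, P\<^sub>n\<^sub>-\<^sub>1)\<close> to \<open>(0, \<dots>, 0, P\<^sub>n)\<close>; as \<open>P\<^sub>0 = 1\<close>,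
  replacing the first column by this image does not change the determinant, and expanding along
  that column leaves \<open>P\<^sub>n\<close> times a triangular minor whose sign cancels.\<close>

lemma det_lower_hessenberg:
  fixes a :: "nat \<Rightarrow> nat \<Rightarrow> 'a :: comm_ring_1" and p :: "nat \<Rightarrow> 'a"
  assumes p0: "p 0 = 1"
    and pS: "\<And>i. i < n \<Longrightarrow> p (Suc i) = (\<Sum>j\<le>i. a i j * p j)"
  shows "det (mat n n (\<lambda>(i, j). if j \<le> i then a i j else if j = Suc i then - 1 else 0)) = p n"
proof (cases n)
  case 0
  then show ?thesis using p0 by (simp add: det_dim_zero)
next
  case (Suc m)
  define M where "M = mat n n (\<lambda>(i, j). if j \<le> i then a i j else if j = Suc i then - 1 else 0)"
  \<comment> \<open>\<open>N\<close> is the identity with column 0 replaced by \<open>p\<close>.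
    Right multiplication by it turns column 0 of \<open>M\<close> into the image of \<open>p\<close>
    and keeps the other columns; \<open>p 0 = 1\<close> makes it unit lower triangular.\<close>
  define N where "N = mat n n (\<lambda>(i, j). if j = 0 then p i else if i = j then 1 else 0)"
  have M: "M \<in> carrier_mat n n" and N: "N \<in> carrier_mat n n"
    by (simp_all add: M_def N_def)
  have MN: "M * N \<in> carrier_mat n n" using M N by simp
  have "det N = prod_list (diag_mat N)"
    by (rule det_lower_triangular[OF _ N]) (auto simp: N_def)
  also have "\<dots> = 1"
    unfolding prod_list_diag_prod by (rule prod.neutral) (auto simp: N_def p0)
  finally have detN: "det N = 1" .
  have entry: "(M * N) $$ (i, j) = (\<Sum>k<n. M $$ (i, k) * N $$ (k, j))" if "i < n" "j < n" for i j
    using that by (simp add: M_def N_def scalar_prod_def atLeast0LessThan)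
  have col0: "(M * N) $$ (i, 0) = (if i = m then p n else 0)" if i: "i < n" for i
  proof -
    \<comment> \<open>The superdiagonal -1 contributes \<open>- p (Suc i)\<close>, which cancels the
      recurrence sum. In the last row \<open>i = m\<close> the index \<open>Suc i = n\<close> is out
      of range, so \<open>p n\<close> survives. Writing \<open>k \<in> {..i}\<close> fits
      \<open>sum.inter_restrict\<close>.\<close>
    have "(M * N) $$ (i, 0) =
        (\<Sum>k<n. (if k \<in> {..i} then a i k * p k else 0) + (if k = Suc i then - p k else 0))"
      unfolding entry[OF i, of 0, OF order.strict_trans1[OF le0 i]]
      by (rule sum.cong) (use i in \<open>auto simp: M_def N_def\<close>)
    also have "\<dots> = (\<Sum>k\<in>{..<n} \<inter> {..i}. a i k * p k) + (if Suc i < n then - p (Suc i) else 0)"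
      by (simp add: sum.distrib sum.inter_restrict)
    also have "{..<n} \<inter> {..i} = {..i}" using i by auto
    finally show ?thesis using pS[OF i] i Suc by auto
  qed
  have col: "(M * N) $$ (i, j) = M $$ (i, j)" if ij: "i < n" "j < n" "j \<noteq> 0" for i j
  proof -
    have "(M * N) $$ (i, j) = (\<Sum>k<n. if k = j then M $$ (i, k) else 0)"
      unfolding entry[OF ij(1,2)]
      by (rule sum.cong) (use ij in \<open>auto simp: N_def\<close>)
    then show ?thesis using ij by simp
  qed
  \<comment> \<open>Dropping column 0 moves the superdiagonal of \<open>M\<close> onto the diagonal,
    so this minor is lower triangular with -1 on the diagonal.\<close>
  let ?D = "mat_delete (M * N) m 0"
  have D: "?D \<in> carrier_mat m m"
    using mat_delete_carrier[OF MN] Suc by simp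
  have Dij: "?D $$ (i, j) = M $$ (i, Suc j)" if "i < m" "j < m" for i j
    using mat_delete_index[of "M * N" m m 0 i j] MN Suc that col[of i "Suc j"]
    by (simp add: insert_index_def)
  have "det ?D = prod_list (diag_mat ?D)"
    by (rule det_lower_triangular[OF _ D]) (use Dij Suc in \<open>auto simp: M_def\<close>)
  also have "diag_mat ?D = replicate m (- 1)"
    using D by (intro nth_equalityI) (use Dij Suc in \<open>auto simp: diag_mat_def M_def\<close>)
  finally have detD: "det ?D = (- 1) ^ m" by simp
  have "det M = det (M * N)"
    using det_mult[OF M N] detN by simp
  also have "\<dots> = (\<Sum>i<n. (M * N) $$ (i, 0) * cofactor (M * N) i 0)"
    by (rule laplace_expansion_column[OF MN]) (use Suc in simp)
  also have "\<dots> = (\<Sum>i<n. if i = m then p n * cofactor (M * N) m 0 else 0)"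
    by (rule sum.cong) (auto simp: col0)
  \<comment> \<open>The cofactor sign \<open>(- 1) ^ (m + 0)\<close> meets the minor
    \<open>(- 1) ^ m\<close>; their product is 1.\<close>
  also have "\<dots> = p n"
    using Suc by (simp add: cofactor_def detD flip: power_add mult_2)
  finally show ?thesis by (simp add: M_def)
qed

text \<open>A two-sided inverse makes \<open>A\<close> a unit of the matrix ring, which excludes
  \<open>None\<close>; any returned \<open>C\<close> equals \<open>B\<close> by
  associativity.\<close>

lemma mat_inverse_eqI:
  fixes A B :: "'a :: field mat"
  assumes A: "A \<in> carrier_mat n n" and B: "B \<in> carrier_mat n n"
    and AB: "A * B = 1\<^sub>m n" and BA: "B * A = 1\<^sub>m n"
  shows "mat_inverse A = Some B"
proof (cases "mat_inverse A")
  case None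
  then have "A \<notin> Units (ring_mat TYPE('a) n ())"
    by (rule mat_inverse(1)[OF A])
  then show ?thesis
    using A B AB BA by (auto simp: Units_def ring_mat_simps)
next
  case (Some C)
  then have CA: "C * A = 1\<^sub>m n" and C: "C \<in> carrier_mat n n"
    using mat_inverse(2)[OF A] by auto
  have "C = C * (A * B)" using C by (simp add: AB)
  also have "\<dots> = (C * A) * B" by (rule assoc_mult_mat[OF C A B, symmetric])
  also have "\<dots> = B" using B by (simp add: CA)
  finally have "C = B" .
  with Some show ?thesis by simp
qed

lemma index_diag_mult_mat:
  fixes A :: "'a :: semiring_0 mat"
  assumes "A \<in> carrier_mat n m" "i < n" "j < m"
  shows "(mat n n (\<lambda>(i, j). if i = j then f i else 0) * A) $$ (i, j) = f i * A $$ (i, j)"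
proof -
  have "(mat n n (\<lambda>(i, j). if i = j then f i else 0) * A) $$ (i, j) =
      (\<Sum>k<n. (if i = k then f i else 0) * A $$ (k, j))"
    using assms by (simp add: scalar_prod_def atLeast0LessThan)
  also have "\<dots> = (\<Sum>k<n. if i = k then f i * A $$ (k, j) else 0)"
    by (rule sum.cong) auto
  finally show ?thesis using assms by simp
qed

text \<open>Makes the \<open>the\<close> in the theorem evaluate to an explicit diagonal
  matrix.\<close>

lemma mat_inverse_H_mat:
  assumes "\<And>m. m \<ge> 1 \<Longrightarrow> h m \<noteq> 0"
  shows "mat_inverse (H_mat h n) =
    Some (mat n n (\<lambda>(i, j). if i = j then 1 / complex_of_real (h (i + 1)) else 0))"
proof (rule mat_inverse_eqI)
  let ?D = "mat n n (\<lambda>(i, j). if i = j then 1 / complex_of_real (h (i + 1)) else 0)"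
  show "H_mat h n * ?D = 1\<^sub>m n"
    by (rule eq_matI)
      (use assms in \<open>auto simp: H_mat_def index_diag_mult_mat[where m = n] simp del: index_mult_mat(1)\<close>)
  \<comment> \<open>Removing \<open>index_mult_mat(1)\<close> keeps product entries from unfolding
    to scalar products before \<open>index_diag_mult_mat\<close> applies.\<close>
  show "?D * H_mat h n = 1\<^sub>m n"
    by (rule eq_matI)
      (use assms in \<open>auto simp: H_mat_def index_diag_mult_mat[where m = n] simp del: index_mult_mat(1)\<close>)
qed (simp_all add: H_mat_def)

text \<open>Substituting \<open>j = Suc i - k\<close> puts the recurrence into the row form required
  by \<open>det_lower_hessenberg\<close>.\<close>

lemma poly_darcais_poly_Suc:
  "poly (darcais_poly h (Suc i)) z =
    (\<Sum>j\<le>i. z / complex_of_real (h (Suc i)) * of_nat (divisor_sigma (Suc i - j)) *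
      poly (darcais_poly h j) z)"
proof -
  have "poly (darcais_poly h (Suc i)) z = z / complex_of_real (h (Suc i)) *
      (\<Sum>k = 1..Suc i. of_nat (divisor_sigma k) * poly (darcais_poly h (Suc i - k)) z)"
    unfolding darcais_poly.simps(2) poly_mult poly_sum poly_of_nat by simp
  also have "(\<Sum>k = 1..Suc i. of_nat (divisor_sigma k) * poly (darcais_poly h (Suc i - k)) z) =
      (\<Sum>j\<le>i. of_nat (divisor_sigma (Suc i - j)) * poly (darcais_poly h j) z)"
    by (rule sum.reindex_bij_witness[of _ "\<lambda>j. Suc i - j" "\<lambda>k. Suc i - k"]) auto
  finally show ?thesis
    by (simp only: sum_distrib_left mult.assoc)
qed

theorem proposition3p1:
  fixes h :: "nat \<Rightarrow> real" and n :: nat and z :: complex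
  assumes "\<And>m. m \<ge> 1 \<Longrightarrow> h m > 0"
    and "h 1 = 1"
    and "n \<ge> 1"
  shows "poly (darcais_poly h n) z =
    det (z \<cdot>\<^sub>m (the (mat_inverse (H_mat h n)) * L_mat n) - U_mat n)"
proof -
  \<comment> \<open>Row \<open>i\<close> counts from 0, hence \<open>h (Suc i)\<close>; for
    \<open>j \<le> i\<close> the argument \<open>Suc i - j\<close> agrees with
    \<open>i - j + 1\<close> in \<open>L_mat\<close>.\<close>
  define a where
    "a i j = z / complex_of_real (h (Suc i)) * of_nat (divisor_sigma (Suc i - j))" for i j
  let ?D = "mat n n (\<lambda>(i, j). if i = j then 1 / complex_of_real (h (i + 1)) else 0)"
  have h: "h m \<noteq> 0" if "m \<ge> 1" for m
    using assms(1)[OF that] by simp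
  have DL: "(?D * L_mat n) $$ (i, j) = 1 / complex_of_real (h (Suc i)) * L_mat n $$ (i, j)"
    if "i < n" "j < n" for i j
    using index_diag_mult_mat[of "L_mat n" n n i j "\<lambda>i. 1 / complex_of_real (h (i + 1))"] that
    by (simp add: L_mat_def del: index_mult_mat(1))
  have "z \<cdot>\<^sub>m (?D * L_mat n) - U_mat n =
      mat n n (\<lambda>(i, j). if j \<le> i then a i j else if j = Suc i then - 1 else 0)"
  proof (rule eq_matI)
    fix i j
    assume "i < dim_row (mat n n (\<lambda>(i, j). if j \<le> i then a i j else if j = Suc i then - 1 else 0))"
      and "j < dim_col (mat n n (\<lambda>(i, j). if j \<le> i then a i j else if j = Suc i then - 1 else 0))"
    then have ij: "i < n" "j < n" by auto
    have "(z \<cdot>\<^sub>m (?D * L_mat n) - U_mat n) $$ (i, j) =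
        z * (?D * L_mat n) $$ (i, j) - U_mat n $$ (i, j)"
      using ij by (simp add: L_mat_def U_mat_def)
    then show "(z \<cdot>\<^sub>m (?D * L_mat n) - U_mat n) $$ (i, j) =
        mat n n (\<lambda>(i, j). if j \<le> i then a i j else if j = Suc i then - 1 else 0) $$ (i, j)"
      unfolding DL[OF ij] using ij by (simp add: L_mat_def U_mat_def a_def Suc_diff_le)
  qed (simp_all add: L_mat_def U_mat_def)
  also have "det \<dots> = poly (darcais_poly h n) z"
    by (rule det_lower_hessenberg[of "\<lambda>i. poly (darcais_poly h i) z"])
      (simp_all add: a_def poly_darcais_poly_Suc del: darcais_poly.simps(2))
  finally show ?thesis
    by (simp add: mat_inverse_H_mat[OF h])
qed

end
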